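(* Let $\mathcal{X}$ be a set, let $k:\mathcal{X}\times\mathcal{X}\to(0,\infty)$ be a function, and let $\mathbf{x}=(x_1,\ldots,x_n)$ and $\mathbf{y}=(y_1,\ldots,y_m)$ be two sequences in $\mathcal{X}^\star=\bigcup_{i=1}^\infty\mathcal{X}^i$ (so $n,m\ge 1$). Define the doubly indexed family $M_{i,j}$, $0\le i\le n$, $0\le j\le m$, by $M_{0,0}=1$, $M_{i,0}=0$ for $i=1,\ldots,n$, $M_{0,j}=0$ for $j=1,\ldots,m$, and recursively for $(i,j)\in\{1,\ldots,n\}\times\{1,\ldots,m\}$, $$M_{i,j} = \bigl(M_{i,j-1}+M_{i-1,j-1}+M_{i-1,j}\bigr)\,k(x_i,y_j).$$ Then $$M_{n,m} = K(\mathbf{x},\mathbf{y}) := \sum_{\pi\in\mathcal{A}(\mathbf{x},\mathbf{y})}\ \prod_{i=1}^{|\pi|} k\bigl(x_{\pi_1(i)},\,y_{\pi_2(i)}\bigr),$$ where $\mathcal{A}(\mathbf{x},\mathbf{y})$ is the set of all alignments between $\mathbf{x}$ and $\mathbf{y}$.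
   Context: Alignment: let $\mathbf{x}=(x_1,\ldots,x_n)$ and $\mathbf{y}=(y_1,\ldots,y_m)$ be nonempty finite sequences with values in $\mathcal{X}$. An alignment $\pi$ of length $|\pi|=p$ between $\mathbf{x}$ and $\mathbf{y}$ is a pair $(\pi_1,\pi_2)$ of $p$-tuples of positive integers such that $$1=\pi_1(1)\le\cdots\le\pi_1(p)=n,\qquad 1=\pi_2(1)\le\cdots\le\pi_2(p)=m,$$ and for all $1\le i\le p-1$, $$\pi_1(i+1)\le\pi_1(i)+1,\qquad \pi_2(i+1)\le\pi_2(i)+1,\qquad (\pi_1(i+1)-\pi_1(i))+(\pi_2(i+1)-\pi_2(i))\ge 1.$$ $\mathcal{A}(\mathbf{x},\mathbf{y})$ denotes the (finite) set of all alignments, of all possible lengths $p$, between $\mathbf{x}$ and $\mathbf{y}$. *)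

theory Defs
  imports Complex_Main "HOL-Library.FuncSet"
begin

text \<open>
  Finite sequences and tuples are lists, accessed with indices starting from 1.
  The value of \<open>nth1 xs i\<close> is meaningful for \<open>1 \<le> i \<le> length xs\<close> only.
\<close>

definition nth1 :: "'a list \<Rightarrow> nat \<Rightarrow> 'a" where
  "nth1 xs i = xs ! (i - 1)"

text \<open>
  \<open>alignments n m\<close> is the set of all alignments between a sequence of length \<open>n\<close> and one of
  length \<open>m\<close>. The step condition is stated over the integers, where subtraction does not truncate.
\<close>

definition alignments :: "nat \<Rightarrow> nat \<Rightarrow> (nat list \<times> nat list) set" where
  "alignments n m = {(\<pi>\<^sub>1, \<pi>\<^sub>2). \<exists>p\<ge>1.
     length \<pi>\<^sub>1 = p \<and> length \<pi>\<^sub>2 = p \<and>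
     (\<forall>i\<in>{1..p}. 1 \<le> nth1 \<pi>\<^sub>1 i \<and> 1 \<le> nth1 \<pi>\<^sub>2 i) \<and>
     nth1 \<pi>\<^sub>1 1 = 1 \<and> nth1 \<pi>\<^sub>1 p = n \<and>
     nth1 \<pi>\<^sub>2 1 = 1 \<and> nth1 \<pi>\<^sub>2 p = m \<and>
     (\<forall>i. 1 \<le> i \<and> i \<le> p - 1 \<longrightarrow>
        nth1 \<pi>\<^sub>1 i \<le> nth1 \<pi>\<^sub>1 (i + 1) \<and> nth1 \<pi>\<^sub>2 i \<le> nth1 \<pi>\<^sub>2 (i + 1) \<and>
        nth1 \<pi>\<^sub>1 (i + 1) \<le> nth1 \<pi>\<^sub>1 i + 1 \<and> nth1 \<pi>\<^sub>2 (i + 1) \<le> nth1 \<pi>\<^sub>2 i + 1 \<and>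
        (int (nth1 \<pi>\<^sub>1 (i + 1)) - int (nth1 \<pi>\<^sub>1 i)) +
        (int (nth1 \<pi>\<^sub>2 (i + 1)) - int (nth1 \<pi>\<^sub>2 i)) \<ge> 1)}"

definition alignment_kernel :: "('a \<times> 'a \<Rightarrow> real) \<Rightarrow> 'a list \<Rightarrow> 'a list \<Rightarrow> real" where
  "alignment_kernel k xs ys =
     (\<Sum>(\<pi>\<^sub>1, \<pi>\<^sub>2)\<in>alignments (length xs) (length ys).
        \<Prod>i = 1..length \<pi>\<^sub>1. k (nth1 xs (nth1 \<pi>\<^sub>1 i), nth1 ys (nth1 \<pi>\<^sub>2 i)))"

text \<open>
  The recursion for \<open>M\<^bsub>i,j\<^esub>\<close>. Entries with \<open>i > length xs\<close> or \<open>j > length ys\<close> are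
  irrelevant: the entries inside the range never refer to them.
\<close>

fun alignment_rec :: "('a \<times> 'a \<Rightarrow> real) \<Rightarrow> 'a list \<Rightarrow> 'a list \<Rightarrow> nat \<Rightarrow> nat \<Rightarrow> real" where
  "alignment_rec k xs ys 0 0 = 1"
| "alignment_rec k xs ys (Suc i) 0 = 0"
| "alignment_rec k xs ys 0 (Suc j) = 0"
| "alignment_rec k xs ys (Suc i) (Suc j) =
     (alignment_rec k xs ys (Suc i) j + alignment_rec k xs ys i j + alignment_rec k xs ys i (Suc j))
       * k (nth1 xs (Suc i), nth1 ys (Suc j))"

text \<open>
  The set of alignments is finite, so the sum in \<open>alignment_kernel\<close> is a genuine finite sum.
\<close>

lemma finite_alignments: "finite (alignments n m)"
proof -
  have "(a, b) \<in> {l. set l \<subseteq> {..n} \<and> length l \<le> n + m} \<times> {l. set l \<subseteq> {..m} \<and> length l \<le> n + m}"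
    if ab: "(a, b) \<in> alignments n m" for a b
  proof -
    define p where "p = length a"
    from ab have p: "p \<ge> 1" "length b = p"
      and last: "a ! (p - 1) = n" "b ! (p - 1) = m"
      and step: "\<And>i. 1 \<le> i \<Longrightarrow> i \<le> p - 1 \<Longrightarrow>
        a ! (i - 1) \<le> a ! i \<and> b ! (i - 1) \<le> b ! i \<and>
        int (a ! i) - int (a ! (i - 1)) + (int (b ! i) - int (b ! (i - 1))) \<ge> 1"
      and first: "a ! 0 = 1"
      by (auto simp: alignments_def nth1_def p_def)
    have step': "a ! i \<le> a ! Suc i \<and> b ! i \<le> b ! Suc i \<and> a ! i + b ! i < a ! Suc i + b ! Suc i"
      if "Suc i < p" for i
    proof -
      have "Suc i \<le> p - 1" using that by simp
      with step[of "Suc i"] have "a ! i \<le> a ! Suc i" "b ! i \<le> b ! Suc i"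
        "int (a ! Suc i) - int (a ! i) + (int (b ! Suc i) - int (b ! i)) \<ge> 1"
        by simp_all
      then show ?thesis by linarith
    qed
    have up: "i < p \<Longrightarrow> i < a ! i + b ! i" for i
    proof (induction i)
      case 0
      then show ?case using first by simp
    next
      case (Suc i)
      then show ?case using step'[of i] by linarith
    qed
    have le: "j < p \<Longrightarrow> i \<le> j \<Longrightarrow> a ! i \<le> a ! j \<and> b ! i \<le> b ! j" for i j
    proof (induction j)
      case 0
      then show ?case by simp
    next
      case (Suc j)
      then show ?case using step'[of j] by (cases "i = Suc j") auto
    qed
    have "p \<le> n + m" using up[of "p - 1"] last p by linarith
    moreover have "set a \<subseteq> {..n}" "set b \<subseteq> {..m}"
      using le[of "p - 1"] last p by (auto simp: in_set_conv_nth p_def)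
    ultimately show ?thesis using p by (simp add: p_def)
  qed
  then have "alignments n m \<subseteq>
      {l. set l \<subseteq> {..n} \<and> length l \<le> n + m} \<times> {l. set l \<subseteq> {..m} \<and> length l \<le> n + m}"
    by (rule subrelI)
  then show ?thesis
    by (rule finite_subset) (intro finite_cartesian_product finite_lists_length_le finite_atMost)
qed

end

theory Submission
  imports Defs
begin

text \<open>The inequalities on increments leave exactly three moves, (1,0), (0,1) and (1,1), one
  for each summand of the recursion. Indices start from 0 here to suit list induction and
  appending.\<close>

lemma alignments_iff_nth:
  "(a, b) \<in> alignments n m \<longleftrightarrow>
     a \<noteq> [] \<and> length b = length a \<and> (\<forall>i<length a. 1 \<le> a ! i \<and> 1 \<le> b ! i) \<and>
     a ! 0 = 1 \<and> b ! 0 = 1 \<and> last a = n \<and> last b = m \<and>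
     (\<forall>i. Suc i < length a \<longrightarrow>
        (a ! Suc i, b ! Suc i) \<in> {(Suc (a ! i), b ! i), (a ! i, Suc (b ! i)), (Suc (a ! i), Suc (b ! i))})"
  (is "_ \<longleftrightarrow> _ \<and> _ \<and> ?pos \<and> _ \<and> _ \<and> _ \<and> _ \<and> ?step")
proof -
  have step_iff: "x \<le> x' \<and> y \<le> y' \<and> x' \<le> x + 1 \<and> y' \<le> y + 1 \<and>
      (int x' - int x) + (int y' - int y) \<ge> 1 \<longleftrightarrow>
      (x', y') \<in> {(Suc x, y), (x, Suc y), (Suc x, Suc y)}" for x y x' y' :: nat
    by auto
  have pos: "(\<forall>i\<in>{1..length a}. 1 \<le> nth1 a i \<and> 1 \<le> nth1 b i) \<longleftrightarrow> ?pos"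
    unfolding image_Suc_lessThan[symmetric] ball_simps nth1_def by auto
  \<comment> \<open>Unfolding \<open>nth1\<close> at \<open>i\<close> and \<open>i + 1\<close> gives
    the list indices \<open>i - 1\<close> and \<open>i\<close>.\<close>
  have shift: "(\<forall>i. 1 \<le> i \<and> i \<le> length a - 1 \<longrightarrow> P (i - 1) i) \<longleftrightarrow>
      (\<forall>i. Suc i < length a \<longrightarrow> P i (Suc i))" for P
  proof (intro iffI allI impI)
    fix i assume "\<forall>i. 1 \<le> i \<and> i \<le> length a - 1 \<longrightarrow> P (i - 1) i" "Suc i < length a"
    then show "P i (Suc i)" by (elim allE[of _ "Suc i"]) auto
  next
    fix i assume "\<forall>i. Suc i < length a \<longrightarrow> P i (Suc i)" "1 \<le> i \<and> i \<le> length a - 1"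
    then show "P (i - 1) i" by (elim allE[of _ "i - 1"]) auto
  qed
  show ?thesis
    unfolding alignments_def mem_Collect_eq case_prod_conv step_iff pos[symmetric]
    using shift[of "\<lambda>i j. (a ! j, b ! j) \<in> {(Suc (a ! i), b ! i), (a ! i, Suc (b ! i)), (Suc (a ! i), Suc (b ! i))}"]
    by (cases "a = []"; cases "b = []")
      (auto simp: nth1_def last_conv_nth Suc_le_eq simp del: insert_iff)
qed

text \<open>
  Counting the empty pair as an alignment between two empty sequences makes the initial value
  \<open>1\<close> of the recursion a sum over paths too, so that the recursion step has no special case.
\<close>

definition alignments0 :: "nat \<Rightarrow> nat \<Rightarrow> (nat list \<times> nat list) set" where
  "alignments0 n m = (if n = 0 \<and> m = 0 then {([], [])} else alignments n m)"

lemma finite_alignments0: "finite (alignments0 n m)"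
  by (simp add: alignments0_def finite_alignments)

lemma length_eq_alignments0: "(a, b) \<in> alignments0 n m \<Longrightarrow> length b = length a"
  by (auto simp: alignments0_def alignments_iff_nth split: if_splits)

lemma alignments_pos: "(a, b) \<in> alignments n m \<Longrightarrow> 1 \<le> n \<and> 1 \<le> m"
  by (cases "b = []") (auto simp: alignments_iff_nth last_conv_nth)

text \<open>The last entries of a nonempty pair determine its endpoint, and the empty pair occurs
  only at the origin.\<close>

lemma alignments0_disjoint:
  assumes "(n, m) \<noteq> (n', m')"
  shows "alignments0 n m \<inter> alignments0 n' m' = {}"
  using assms by (auto simp: alignments0_def alignments_iff_nth split: if_splits)

text \<open>The final move into the new corner is one of three, so it starts at one of three
  neighbouring cells. A nonempty \<open>a\<close> ensures that there is such a move.\<close>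

lemma alignments_snoc_iff:
  assumes "a \<noteq> []"
  shows "(a @ [Suc n], b @ [Suc m]) \<in> alignments (Suc n) (Suc m) \<longleftrightarrow>
    (a, b) \<in> alignments (Suc n) m \<union> alignments n m \<union> alignments n (Suc m)"
proof -
  define q where "q = length a - 1"
  have q: "length a = Suc q" using assms by (simp add: q_def)
  \<comment> \<open>Splitting off the largest index separates the final move, at index
    \<open>q\<close>, from the moves within \<open>(a, b)\<close>.\<close>
  have all_less: "(\<forall>i<Suc l. P i) \<longleftrightarrow> (\<forall>i<l. P i) \<and> P l" for P and l :: nat
    by (auto simp: less_Suc_eq)
  show ?thesis
  proof (cases "length b = Suc q")
    case True
    then have "b \<noteq> []" by auto
    with True q assms show ?thesis
      by (auto simp: alignments_iff_nth all_less nth_append last_conv_nth)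
  next
    case False
    with q show ?thesis by (auto simp: alignments_iff_nth)
  qed
qed

lemma alignments0_Suc_Suc:
  "alignments0 (Suc n) (Suc m) =
    (\<lambda>(a, b). (a @ [Suc n], b @ [Suc m])) `
      (alignments0 (Suc n) m \<union> alignments0 n m \<union> alignments0 n (Suc m))"
  (is "?L = ?ext ` ?R")
proof -
  have snoc: "(a @ [Suc n], b @ [Suc m]) \<in> ?L \<longleftrightarrow> (a, b) \<in> ?R" for a b
  proof (cases "a = []")
    case True
    \<comment> \<open>A one-point alignment ends at (1,1), and its truncation is the empty pair,
      found only in \<open>alignments0 0 0\<close>.\<close>
    then show ?thesis
      by (auto simp: alignments0_def alignments_iff_nth)
  next
    case False
    then show ?thesis
      \<comment> \<open>At the origin \<open>alignments0\<close> and \<open>alignments\<close>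
        differ, but neither contains a pair with nonempty \<open>a\<close>.\<close>
      using alignments_snoc_iff[OF False, of n b m] alignments_pos[of a b 0 0]
      by (auto simp: alignments0_def)
  qed
  have "\<pi> \<in> ?ext ` ?R" if "\<pi> \<in> ?L" for \<pi>
  proof -
    obtain a b where \<pi>: "\<pi> = (a, b)" by (cases \<pi>)
    with that have "a \<noteq> []" "b \<noteq> []" "last a = Suc n" "last b = Suc m"
      by (auto simp: alignments0_def alignments_iff_nth)
    then have "a = butlast a @ [Suc n]" "b = butlast b @ [Suc m]"
      by (metis append_butlast_last_id)+
    with that \<pi> snoc show ?thesis
      by (metis (mono_tags, lifting) case_prod_conv image_eqI)
  qed
  with snoc show ?thesis by auto
qed

text \<open>Weights sit on grid cells, so the path decomposition is independent of the sequences and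
  of \<open>k\<close>.\<close>

definition path_weight :: "(nat \<Rightarrow> nat \<Rightarrow> real) \<Rightarrow> nat list \<times> nat list \<Rightarrow> real" where
  "path_weight f = (\<lambda>(a, b). \<Prod>i = 1..length a. f (nth1 a i) (nth1 b i))"

lemma path_weight_snoc:
  assumes "length b = length a"
  shows "path_weight f (a @ [n], b @ [m]) = path_weight f (a, b) * f n m"
  using assms by (simp add: path_weight_def nth1_def nth_append prod.atLeast1_atMost_eq)

lemma sum_path_weight_Suc_Suc:
  "sum (path_weight f) (alignments0 (Suc n) (Suc m)) =
    (sum (path_weight f) (alignments0 (Suc n) m) + sum (path_weight f) (alignments0 n m) +
     sum (path_weight f) (alignments0 n (Suc m))) * f (Suc n) (Suc m)"
proof -
  let ?ext = "\<lambda>(a, b). (a @ [Suc n], b @ [Suc m])"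
  let ?R = "alignments0 (Suc n) m \<union> alignments0 n m \<union> alignments0 n (Suc m)"
  have "sum (path_weight f) (alignments0 (Suc n) (Suc m)) = (\<Sum>\<pi>\<in>?R. path_weight f (?ext \<pi>))"
    \<comment> \<open>Appending a fixed cell is injective, so no path is counted twice.\<close>
    unfolding alignments0_Suc_Suc by (subst sum.reindex) (auto simp: inj_on_def)
  also have "\<dots> = (\<Sum>\<pi>\<in>?R. path_weight f \<pi> * f (Suc n) (Suc m))"
    by (intro sum.cong refl) (auto dest!: length_eq_alignments0 simp: path_weight_snoc)
  also have "\<dots> = sum (path_weight f) ?R * f (Suc n) (Suc m)"
    by (simp add: sum_distrib_right)
  also have "sum (path_weight f) ?R =
      sum (path_weight f) (alignments0 (Suc n) m) + sum (path_weight f) (alignments0 n m) +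
      sum (path_weight f) (alignments0 n (Suc m))"
    by (simp add: sum.union_disjoint finite_alignments0 alignments0_disjoint Int_Un_distrib2)
  finally show ?thesis .
qed

text \<open>The induction needs all entries, not only the corner. The value 1 at the origin is the
  empty product; the boundary zeros are empty sums, as endpoints of alignments have positive
  coordinates.\<close>

lemma alignment_rec_eq_sum:
  "alignment_rec k xs ys n m =
    sum (path_weight (\<lambda>i j. k (nth1 xs i, nth1 ys j))) (alignments0 n m)"
proof (induction k xs ys n m rule: alignment_rec.induct)
  case (1 k xs ys)
  then show ?case by (simp add: alignments0_def path_weight_def)
next
  case (2 k xs ys i)
  have "alignments0 (Suc i) 0 = {}"
    using alignments_pos by (fastforce simp: alignments0_def)
  then show ?case by simp
next
  case (3 k xs ys j)
  have "alignments0 0 (Suc j) = {}"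
    using alignments_pos by (fastforce simp: alignments0_def)
  then show ?case by simp
next
  case (4 k xs ys i j)
  then show ?case by (simp add: sum_path_weight_Suc_Suc)
qed

theorem theorem2:
  fixes X :: "'a set" and k :: "'a \<times> 'a \<Rightarrow> real" and xs ys :: "'a list"
  assumes "k \<in> X \<times> X \<rightarrow> {0<..}"
    and "xs \<in> lists X" and "xs \<noteq> []"
    and "ys \<in> lists X" and "ys \<noteq> []"
  shows "alignment_rec k xs ys (length xs) (length ys) = alignment_kernel k xs ys"
  \<comment> \<open>For nonempty \<open>xs\<close> the corner is not the origin, so
    \<open>alignments0\<close> is \<open>alignments\<close> there.\<close>
  using assms(3)
  by (simp add: alignment_rec_eq_sum alignments0_def alignment_kernel_def path_weight_def)

end
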